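(* Let $\xi=(\xi(k))_{k\ge 0}$ be a discrete-time stationary $\mathbb{R}^d$-valued process with $\mathbf{E}\,\xi(0)=0$, with finite second moments and summable correlations; that is, with $\Delta(n):=\mathbf{E}(\xi(0)\otimes\xi(n))$ for $n=0,1,2,\dots$, \[ \Delta(0)\quad\text{and}\quad \sum_{n=1}^{\infty}\Delta(n)\quad\text{are finite.} \] Consider the rescaled piecewise constant partial sums and their iterated sums \[ S_N(t):=\frac{1}{N^{1/2}}\sum_{0\le k<[Nt]}\xi(k),\qquad \mathbb{S}_N(t):=\frac1N\sum_{0\le k<\ell<[Nt]}\xi(k)\otimes\xi(\ell). \] If the iterated invariance principle holds for $(S_N,\mathbb{S}_N)$ with a Brownian rough path limit $(B,\mathbb{B})$ over $\mathbb{R}^d$, then $(B,\mathbb{B})$ necessarily has characteristics $(\Sigma,\Gamma)$ given by \[ \Sigma=\Delta(0)+2\,\mathrm{Sym}(\Gamma)\quad\text{and}\quad \Gamma=\sum_{n=1}^{\infty}\Delta(n). \]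
   Context: Conventions: $(x\otimes y)^{i,j}=x^iy^j$ for $x,y\in\mathbb{R}^d$; $(\mathbb{R}^d)^{\otimes 2}$ is identified with $d\times d$ matrices; expectations of random vectors and matrices are taken component-wise; $\mathrm{Sym}(M)=\frac12(M+M^T)$ is the symmetric part of $M$; $[x]$ is the integer part of $x$. Brownian rough path: a Brownian rough path over $\mathbb{R}^d$ with characteristics $(\Sigma,\Gamma)\in(\mathbb{R}^d)^{\otimes2}\times(\mathbb{R}^d)^{\otimes2}$ is any process $t\mapsto(B(t),\mathbb{B}(t))$, where $B$ is a $d$-dimensional Brownian motion with covariance $\Sigma=\mathbf{E}(B(1)\otimes B(1))$ and $\mathbb{B}(t)=\int_0^tB\otimes\mathrm{d}B+t\Gamma$, i.e. $\mathbb{B}^{i,j}(t)=\int_0^tB^i(s)\,\mathrm{d}B^j(s)+t\,\Gamma^{i,j}$, with the integral in the sense of Itô. In particular $\Gamma=\mathbf{E}(\mathbb{B}(1))$. Iterated invariance principle: let $t\mapsto(S_N(t),\mathbb{S}_N(t))$, $N\ge1$, be random processes on $\mathbb{R}^d\times(\mathbb{R}^d)^{\otimes2}$. The iterated invariance principle holds for $(S_N,\mathbb{S}_N)$ with Brownian rough path limit $(B,\mathbb{B})$ if (1) for all $t$, the sequence $(S_N(t),\mathbb{S}_N(t))$ converges in law to $(B(t),\mathbb{B}(t))$ as $N\to\infty$; and (2) $\mathbf{E}(S_N(1)\otimes S_N(1))\to\mathbf{E}(B(1)\otimes B(1))$ and $\mathbf{E}(\mathbb{S}_N(1))\to\mathbf{E}(\mathbb{B}(1))$.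 *)

theory Defs
  imports "HOL-Probability.Probability"
begin

definition outer :: "real ^ 'd \<Rightarrow> real ^ 'd \<Rightarrow> real ^ 'd ^ 'd"  (infixl "\<otimes>\<^sub>v" 75)
  where "x \<otimes>\<^sub>v y = (\<chi> i j. x $ i * y $ j)"

definition Sym :: "real ^ 'd ^ 'd \<Rightarrow> real ^ 'd ^ 'd"
  where "Sym A = (1 / 2) *\<^sub>R (A + transpose A)"

text \<open>Strict stationarity: every time shift leaves the law on path space unchanged.\<close>

definition stationary_process :: "'a measure \<Rightarrow> (nat \<Rightarrow> 'a \<Rightarrow> real ^ 'd) \<Rightarrow> bool"
  where "stationary_process P \<xi> \<longleftrightarrow>
    (\<forall>k. \<xi> k \<in> borel_measurable P) \<and>
    (\<forall>m. distr P (\<Pi>\<^sub>M k\<in>UNIV. borel) (\<lambda>\<omega> k. \<xi> (k + m) \<omega>) =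
         distr P (\<Pi>\<^sub>M k\<in>UNIV. borel) (\<lambda>\<omega> k. \<xi> k \<omega>))"

text \<open>For integrable vectors and matrices the Bochner integral is the component-wise one.\<close>

definition correlation :: "'a measure \<Rightarrow> (nat \<Rightarrow> 'a \<Rightarrow> real ^ 'd) \<Rightarrow> nat \<Rightarrow> real ^ 'd ^ 'd"
  where "correlation P \<xi> n = prob_space.expectation P (\<lambda>\<omega>. \<xi> 0 \<omega> \<otimes>\<^sub>v \<xi> n \<omega>)"

definition partial_sum :: "(nat \<Rightarrow> 'a \<Rightarrow> real ^ 'd) \<Rightarrow> nat \<Rightarrow> real \<Rightarrow> 'a \<Rightarrow> real ^ 'd"
  where "partial_sum \<xi> N t \<omega> = (1 / sqrt (real N)) *\<^sub>R (\<Sum>k<nat \<lfloor>real N * t\<rfloor>. \<xi> k \<omega>)"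

definition iterated_sum :: "(nat \<Rightarrow> 'a \<Rightarrow> real ^ 'd) \<Rightarrow> nat \<Rightarrow> real \<Rightarrow> 'a \<Rightarrow> real ^ 'd ^ 'd"
  where "iterated_sum \<xi> N t \<omega> =
    (1 / real N) *\<^sub>R (\<Sum>l<nat \<lfloor>real N * t\<rfloor>. \<Sum>k<l. \<xi> k \<omega> \<otimes>\<^sub>v \<xi> l \<omega>)"

text \<open>The case \<open>v = 0\<close> is the point mass at 0, so that degenerate covariances are allowed.\<close>

definition centred_normal :: "'a measure \<Rightarrow> real \<Rightarrow> ('a \<Rightarrow> real) \<Rightarrow> bool"
  where "centred_normal M v X \<longleftrightarrow> X \<in> borel_measurable M \<and> 0 \<le> v \<and>
    (if v = 0 then AE \<omega> in M. X \<omega> = 0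
     else distributed M lborel X (normal_density 0 (sqrt v)))"

definition natural_filtration :: "'a measure \<Rightarrow> (real \<Rightarrow> 'a \<Rightarrow> 'b::topological_space) \<Rightarrow> real \<Rightarrow> 'a measure"
  where "natural_filtration M X s =
    sigma (space M) (\<Union>r\<in>{0..s}. sets (vimage_algebra (space M) (X r) borel))"

text \<open>
  Processes are indexed by \<open>real\<close>, but only times \<open>t \<ge> 0\<close> are relevant. A random vector is
  Gaussian iff all its linear functionals are normal (possibly degenerate). Their variances
  determine only the symmetric part of \<open>C\<close>, so symmetry is required separately; together these
  conditions say that \<open>C\<close> is the expectation of \<open>B 1 \<otimes>\<^sub>v B 1\<close>.
\<close>

definition brownian_motion :: "'a measure \<Rightarrow> real ^ 'd ^ 'd \<Rightarrow> (real \<Rightarrow> 'a \<Rightarrow> real ^ 'd) \<Rightarrow> bool"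
  where "brownian_motion M C B \<longleftrightarrow>
    prob_space M \<and> transpose C = C \<and>
    (\<forall>t\<ge>0. B t \<in> borel_measurable M) \<and>
    (AE \<omega> in M. B 0 \<omega> = 0) \<and>
    (AE \<omega> in M. continuous_on {0..} (\<lambda>t. B t \<omega>)) \<and>
    (\<forall>s t. 0 \<le> s \<and> s < t \<longrightarrow>
      prob_space.indep_set M (sets (natural_filtration M B s))
        (sets (vimage_algebra (space M) (\<lambda>\<omega>. B t \<omega> - B s \<omega>) borel)) \<and>
      (\<forall>u. centred_normal M ((t - s) * (u \<bullet> (C *v u))) (\<lambda>\<omega>. u \<bullet> (B t \<omega> - B s \<omega>))))"

text \<open>
  Simple integrands on \<open>[0, t]\<close>: the sum over \<open>k < n\<close> of \<open>\<eta> k\<close> times the indicator of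
  \<open>(\<tau> k, \<tau> (k + 1)]\<close>, with square-integrable coefficients that are measurable at the left
  end point.
\<close>

definition simple_integrand ::
  "'a measure \<Rightarrow> (real \<Rightarrow> 'a measure) \<Rightarrow> real \<Rightarrow> nat \<Rightarrow> (nat \<Rightarrow> real) \<Rightarrow> (nat \<Rightarrow> 'a \<Rightarrow> real) \<Rightarrow> bool"
  where "simple_integrand M F t n \<tau> \<eta> \<longleftrightarrow>
    0 \<le> \<tau> 0 \<and> \<tau> n \<le> t \<and>
    (\<forall>k<n. \<tau> k < \<tau> (Suc k) \<and> \<eta> k \<in> borel_measurable (F (\<tau> k)) \<and> integrable M (\<lambda>\<omega>. (\<eta> k \<omega>)\<^sup>2))"

definition simple_value :: "nat \<Rightarrow> (nat \<Rightarrow> real) \<Rightarrow> (nat \<Rightarrow> 'a \<Rightarrow> real) \<Rightarrow> real \<Rightarrow> 'a \<Rightarrow> real"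
  where "simple_value n \<tau> \<eta> s \<omega> = (\<Sum>k<n. \<eta> k \<omega> * indicator {\<tau> k<..\<tau> (Suc k)} s)"

definition simple_integral ::
  "(real \<Rightarrow> 'a \<Rightarrow> real) \<Rightarrow> nat \<Rightarrow> (nat \<Rightarrow> real) \<Rightarrow> (nat \<Rightarrow> 'a \<Rightarrow> real) \<Rightarrow> 'a \<Rightarrow> real"
  where "simple_integral W n \<tau> \<eta> \<omega> = (\<Sum>k<n. \<eta> k \<omega> * (W (\<tau> (Suc k)) \<omega> - W (\<tau> k) \<omega>))"

text \<open>
  \<open>has_ito_integral M F H W t I\<close>: the random variable \<open>I\<close> is a version of the Ito integral of
  \<open>H\<close> against \<open>W\<close> over \<open>[0, t]\<close>, that is, the \<open>L\<^sup>2\<close> limit of the integrals of simple integrands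
  approximating \<open>H\<close> in \<open>L\<^sup>2\<close>. By the Ito isometry \<open>I\<close> is almost surely unique and independent of
  the approximating sequence when \<open>W\<close> is a Brownian motion relative to \<open>F\<close>.
\<close>

definition has_ito_integral ::
  "'a measure \<Rightarrow> (real \<Rightarrow> 'a measure) \<Rightarrow> (real \<Rightarrow> 'a \<Rightarrow> real) \<Rightarrow> (real \<Rightarrow> 'a \<Rightarrow> real) \<Rightarrow> real \<Rightarrow> ('a \<Rightarrow> real) \<Rightarrow> bool"
  where "has_ito_integral M F H W t I \<longleftrightarrow> I \<in> borel_measurable M \<and>
    (\<exists>n \<tau> \<eta>.
      (\<forall>m. simple_integrand M F t (n m) (\<tau> m) (\<eta> m)) \<and>
      (\<lambda>m. \<integral>\<^sup>+ s\<in>{0..t}. (\<integral>\<^sup>+ \<omega>. ennreal ((simple_value (n m) (\<tau> m) (\<eta> m) s \<omega> - H s \<omega>)\<^sup>2) \<partial>M) \<partial>lborel)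
        \<longlonglongrightarrow> 0 \<and>
      (\<lambda>m. \<integral>\<^sup>+ \<omega>. ennreal ((simple_integral W (n m) (\<tau> m) (\<eta> m) \<omega> - I \<omega>)\<^sup>2) \<partial>M) \<longlonglongrightarrow> 0)"

text \<open>
  \<open>BB t\<close> has entries \<open>\<integral>\<^sub>0\<^sup>t B\<^sup>i dB\<^sup>j + t \<Gamma>\<^sup>i\<^sup>j\<close>. The Ito integral is determined for each \<open>t\<close> up to null
  sets only, so this is required for each fixed \<open>t\<close>, almost surely.
\<close>

definition brownian_rough_path ::
  "'a measure \<Rightarrow> real ^ 'd ^ 'd \<Rightarrow> real ^ 'd ^ 'd \<Rightarrow>
    (real \<Rightarrow> 'a \<Rightarrow> real ^ 'd) \<Rightarrow> (real \<Rightarrow> 'a \<Rightarrow> real ^ 'd ^ 'd) \<Rightarrow> bool"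
  where "brownian_rough_path M C \<Gamma> B BB \<longleftrightarrow>
    brownian_motion M C B \<and>
    (\<forall>t\<ge>0. BB t \<in> borel_measurable M) \<and>
    (\<forall>t\<ge>0. \<forall>i j. has_ito_integral M (natural_filtration M B)
      (\<lambda>s \<omega>. B s \<omega> $ i) (\<lambda>s \<omega>. B s \<omega> $ j) t (\<lambda>\<omega>. BB t \<omega> $ i $ j - t * \<Gamma> $ i $ j))"

definition converges_in_law ::
  "(nat \<Rightarrow> 'a measure) \<Rightarrow> (nat \<Rightarrow> 'a \<Rightarrow> 'c::metric_space) \<Rightarrow> 'b measure \<Rightarrow> ('b \<Rightarrow> 'c) \<Rightarrow> bool"
  where "converges_in_law P X Q Y \<longleftrightarrow>
    (\<forall>f :: 'c \<Rightarrow> real. continuous_on UNIV f \<and> bounded (range f) \<longrightarrow>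
      (\<lambda>N. prob_space.expectation (P N) (\<lambda>\<omega>. f (X N \<omega>)))
        \<longlonglongrightarrow> prob_space.expectation Q (\<lambda>\<omega>. f (Y \<omega>)))"

text \<open>
  The processes with index \<open>N\<close> live on their own probability space \<open>P N\<close>. The integrability
  conditions make explicit that the expectations in the convergence of moments exist.
\<close>

definition iterated_invariance_principle ::
  "(nat \<Rightarrow> 'a measure) \<Rightarrow> (nat \<Rightarrow> real \<Rightarrow> 'a \<Rightarrow> real ^ 'd) \<Rightarrow> (nat \<Rightarrow> real \<Rightarrow> 'a \<Rightarrow> real ^ 'd ^ 'd) \<Rightarrow>
    'b measure \<Rightarrow> (real \<Rightarrow> 'b \<Rightarrow> real ^ 'd) \<Rightarrow> (real \<Rightarrow> 'b \<Rightarrow> real ^ 'd ^ 'd) \<Rightarrow> bool"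
  where "iterated_invariance_principle P S SS Q B BB \<longleftrightarrow>
    (\<forall>N\<ge>1. prob_space (P N)) \<and> prob_space Q \<and>
    (\<forall>N\<ge>1. \<forall>t\<ge>0. S N t \<in> borel_measurable (P N) \<and> SS N t \<in> borel_measurable (P N)) \<and>
    (\<forall>t\<ge>0. B t \<in> borel_measurable Q \<and> BB t \<in> borel_measurable Q) \<and>
    (\<forall>t\<ge>0. converges_in_law P (\<lambda>N \<omega>. (S N t \<omega>, SS N t \<omega>)) Q (\<lambda>\<omega>. (B t \<omega>, BB t \<omega>))) \<and>
    (\<forall>N\<ge>1. integrable (P N) (\<lambda>\<omega>. S N 1 \<omega> \<otimes>\<^sub>v S N 1 \<omega>) \<and> integrable (P N) (SS N 1)) \<and>
    integrable Q (\<lambda>\<omega>. B 1 \<omega> \<otimes>\<^sub>v B 1 \<omega>) \<and> integrable Q (BB 1) \<and>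
    (\<lambda>N. prob_space.expectation (P N) (\<lambda>\<omega>. S N 1 \<omega> \<otimes>\<^sub>v S N 1 \<omega>))
      \<longlonglongrightarrow> prob_space.expectation Q (\<lambda>\<omega>. B 1 \<omega> \<otimes>\<^sub>v B 1 \<omega>) \<and>
    (\<lambda>N. prob_space.expectation (P N) (SS N 1)) \<longlonglongrightarrow> prob_space.expectation Q (BB 1)"

end

theory Submission
  imports Defs
begin

text \<open>
  The characteristics are moments of the limit at time 1: \<open>C\<close> is the mean of \<open>B 1 \<otimes>\<^sub>v B 1\<close> and
  \<open>\<Gamma>\<close> is the mean of \<open>BB 1\<close>. By the convergence of moments they are the limits of the
  corresponding discrete moments, which can be computed in terms of the correlations.

  On the side of the limit, \<open>B 1\<close> has covariance \<open>C\<close> because its linear functionals have the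
  right variances (\<open>brownian_motion_covariance\<close>), and \<open>BB 1\<close> has mean \<open>\<Gamma>\<close> because Ito integrals
  have mean zero (\<open>ito_integral_mean_zero\<close>, \<open>brownian_rough_path_mean\<close>).

  On the discrete side, a gap \<open>l - k = n\<close> contributes the correlation at lag \<open>n\<close> to the mean of the
  iterated sum, by stationarity. Grouped by \<open>l\<close>, these contributions are partial sums of the
  correlation series, and the normalisation \<open>1 / N\<close> turns them into their Cesaro means
  (\<open>expectation_iterated_sum\<close>), which converge to the sum of the series. This gives \<open>\<Gamma>\<close>. Finally,
  the square of a sum splits into its diagonal, the iterated sum and the transpose of the iterated
  sum (\<open>partial_sum_outer_decompose\<close>). In expectation the diagonal is the correlation at lag 0, so
  \<open>C\<close> is the sum of that correlation, \<open>\<Gamma>\<close> and the transpose of \<open>\<Gamma>\<close>.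
\<close>

section \<open>Averages and the outer product\<close>

text \<open>
  The terms before some index \<open>m\<close> have a fixed total deviation \<open>K\<close>, which the factor \<open>1 / N\<close>
  makes negligible; all later terms are within \<open>e / 2\<close> of the limit.
\<close>

lemma cesaro_mean_tendsto:
  fixes a :: "nat \<Rightarrow> 'a::real_normed_vector"
  assumes "a \<longlonglongrightarrow> L"
  shows "(\<lambda>N. (1 / real N) *\<^sub>R (\<Sum>n<N. a n)) \<longlonglongrightarrow> L"
proof (rule LIMSEQ_I)
  fix e :: real assume "e > 0"
  then obtain m where m: "norm (a n - L) < e / 2" if "n \<ge> m" for n
    using LIMSEQ_D[OF assms, of "e / 2"] by auto
  define K where "K = (\<Sum>n<m. norm (a n - L))"
  obtain M :: nat where M: "real M > 2 * K / e"
    using reals_Archimedean2 by blast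
  have "norm ((1 / real N) *\<^sub>R (\<Sum>n<N. a n) - L) < e" if N: "N \<ge> max (Suc m) M" for N
  proof -
    have N0: "real N > 0" and mN: "m \<le> N" using N by auto
    have "2 * K / e < real N" using M N by linarith
    then have K: "K < real N * (e / 2)" using \<open>e > 0\<close> by (simp add: field_simps)
    have "norm (\<Sum>n<N. a n - L) \<le> (\<Sum>n<N. norm (a n - L))" by (rule norm_sum)
    also have "\<dots> = K + (\<Sum>n\<in>{m..<N}. norm (a n - L))"
      unfolding K_def using mN
      by (metis (no_types, lifting) atLeast0LessThan sum.atLeastLessThan_concat zero_le)
    also have "(\<Sum>n\<in>{m..<N}. norm (a n - L)) \<le> real (card {m..<N}) * (e / 2)"
      by (rule sum_bounded_above) (use m less_imp_le in auto)
    also have "\<dots> \<le> real N * (e / 2)"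
      using \<open>e > 0\<close> by (intro mult_right_mono) auto
    finally have "norm (\<Sum>n<N. a n - L) < real N * e" using K by simp
    moreover have "(1 / real N) *\<^sub>R (\<Sum>n<N. a n) - L = (1 / real N) *\<^sub>R (\<Sum>n<N. a n - L)"
      using N0 by (simp add: sum_subtractf scaleR_diff_right sum_constant_scaleR)
    ultimately show ?thesis using N0 by (simp add: field_simps)
  qed
  then show "\<exists>no. \<forall>n\<ge>no. norm ((1 / real n) *\<^sub>R (\<Sum>n<n. a n) - L) < e" by blast
qed

lemma outer_nth [simp]: "(x \<otimes>\<^sub>v y) $ i $ j = x $ i * y $ j"
  by (simp add: outer_def)

lemma transpose_nth [simp]: "transpose A $ i $ j = A $ j $ i"
  by (simp add: transpose_def)

lemma bounded_bilinear_outer: "bounded_bilinear (\<otimes>\<^sub>v)"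
  unfolding bilinear_conv_bounded_bilinear[symmetric]
  by (auto simp: bilinear_def linear_iff vec_eq_iff algebra_simps)

interpretation outer: bounded_bilinear "(\<otimes>\<^sub>v)"
  by (rule bounded_bilinear_outer)

lemma bounded_linear_transpose:
  "bounded_linear (transpose :: real ^ 'd ^ 'd \<Rightarrow> real ^ 'd ^ 'd)"
  by (auto simp: linear_conv_bounded_linear[symmetric] linear_iff vec_eq_iff)

lemma bounded_linear_entry: "bounded_linear (\<lambda>A :: real ^ 'd ^ 'd. A $ i $ j)"
  by (intro bounded_linear_compose[OF bounded_linear_vec_nth] bounded_linear_vec_nth)

lemma bounded_linear_quadratic_form:
  "bounded_linear (\<lambda>A :: real ^ 'd ^ 'd. u \<bullet> (A *v u))"
  by (auto simp: linear_conv_bounded_linear[symmetric] linear_iff matrix_vector_mult_add_rdistrib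
      inner_add_right scaleR_matrix_vector_assoc[symmetric])

text \<open>
  This turns the variances of the linear functionals of a random vector into the quadratic form
  of the mean of its outer square.
\<close>

lemma quadratic_form_outer: "u \<bullet> ((x \<otimes>\<^sub>v x) *v u) = (u \<bullet> x)\<^sup>2"
proof -
  have "(x \<otimes>\<^sub>v x) *v u = (u \<bullet> x) *\<^sub>R x"
    by (auto simp: vec_eq_iff matrix_vector_mult_def inner_vec_def sum_distrib_left sum_distrib_right
        mult_ac intro!: sum.cong)
  then show ?thesis by (simp add: power2_eq_square)
qed

text \<open>
  Polarisation: evaluating the form of the difference at \<open>axis i 1 + axis j 1\<close> leaves twice its
  \<open>(i, j)\<close> entry.
\<close>

lemma symmetric_matrix_eqI:
  fixes A A' :: "real ^ 'd ^ 'd"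
  assumes "transpose A = A" "transpose A' = A'"
    and quad: "\<And>u. u \<bullet> (A *v u) = u \<bullet> (A' *v u)"
  shows "A = A'"
proof -
  define D where "D = A - A'"
  have D: "u \<bullet> (D *v u) = 0" for u
    using quad[of u] by (simp add: D_def matrix_vector_mult_diff_rdistrib inner_diff_right)
  have sym: "D $ i $ j = D $ j $ i" for i j
    using assms(1,2) by (metis D_def transpose_nth vector_minus_component)
  have ent: "axis i 1 \<bullet> (D *v axis j 1) = D $ i $ j" for i j
    by (simp add: matrix_vector_mult_basis inner_axis' column_def)
  have "D $ i $ j = 0" for i j
    using D[of "axis i 1 + axis j 1"] D[of "axis i 1"] D[of "axis j 1"] sym[of i j]
    by (simp add: matrix_vector_right_distrib inner_add_left inner_add_right ent)
  then show ?thesis by (simp add: D_def vec_eq_iff)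
qed

section \<open>Moments of the discrete process\<close>

lemma integrable_outer:
  fixes X Y :: "'a \<Rightarrow> real ^ 'd"
  assumes [measurable]: "X \<in> borel_measurable M" "Y \<in> borel_measurable M"
    and "integrable M (\<lambda>\<omega>. (norm (X \<omega>))\<^sup>2)" "integrable M (\<lambda>\<omega>. (norm (Y \<omega>))\<^sup>2)"
  shows "integrable M (\<lambda>\<omega>. X \<omega> \<otimes>\<^sub>v Y \<omega>)"
proof -
  obtain K where K: "K > 0" "norm (x \<otimes>\<^sub>v y) \<le> norm x * norm y * K" for x y :: "real ^ 'd"
    using outer.pos_bounded by blast
  show ?thesis
  proof (rule Bochner_Integration.integrable_bound)
    show "integrable M (\<lambda>\<omega>. K * ((norm (X \<omega>))\<^sup>2 + (norm (Y \<omega>))\<^sup>2))"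
      using assms by simp
    show "(\<lambda>\<omega>. X \<omega> \<otimes>\<^sub>v Y \<omega>) \<in> borel_measurable M"
      by (rule borel_measurable_continuous_Pair) (auto intro!: continuous_intros outer.continuous_on)
    have "norm (x \<otimes>\<^sub>v y) \<le> norm (K * ((norm x)\<^sup>2 + (norm y)\<^sup>2))" for x y :: "real ^ 'd"
    proof -
      have "2 * (norm x * norm y) \<le> (norm x)\<^sup>2 + (norm y)\<^sup>2"
        using sum_squares_bound[of "norm x" "norm y"] by simp
      moreover have "0 \<le> norm x * norm y" by simp
      ultimately have "norm x * norm y \<le> (norm x)\<^sup>2 + (norm y)\<^sup>2" by linarith
      then have "norm x * norm y * K \<le> K * ((norm x)\<^sup>2 + (norm y)\<^sup>2)"
        using K(1) by (simp add: mult.commute)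
      with K(2)[of x y] have "norm (x \<otimes>\<^sub>v y) \<le> K * ((norm x)\<^sup>2 + (norm y)\<^sup>2)" by linarith
      then show ?thesis by simp
    qed
    then show "AE \<omega> in M. norm (X \<omega> \<otimes>\<^sub>v Y \<omega>) \<le> norm (K * ((norm (X \<omega>))\<^sup>2 + (norm (Y \<omega>))\<^sup>2))"
      by simp
  qed
qed

text \<open>
  The pair at times \<open>k, l\<close> is the path shifted by \<open>k\<close>, evaluated at \<open>0, l - k\<close>; the shift does not
  change the law of the path.
\<close>

lemma stationary_expectation_outer:
  fixes \<xi> :: "nat \<Rightarrow> 'a \<Rightarrow> real ^ 'd"
  assumes "stationary_process P \<xi>" and "k \<le> l"
  shows "integral\<^sup>L P (\<lambda>\<omega>. \<xi> k \<omega> \<otimes>\<^sub>v \<xi> l \<omega>) = correlation P \<xi> (l - k)"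
proof -
  have [measurable]: "\<xi> k \<in> borel_measurable P" for k
    using assms(1) by (simp add: stationary_process_def)
  let ?\<Pi> = "\<Pi>\<^sub>M k\<in>(UNIV::nat set). (borel :: (real ^ 'd) measure)"
  have f: "(\<lambda>x. x 0 \<otimes>\<^sub>v x (l - k)) \<in> borel_measurable ?\<Pi>"
    by (rule borel_measurable_continuous_Pair) (auto intro!: continuous_intros outer.continuous_on)
  have path: "(\<lambda>\<omega> n. \<xi> (n + m) \<omega>) \<in> P \<rightarrow>\<^sub>M ?\<Pi>" for m
    by (intro measurable_PiM_single') auto
  have "integral\<^sup>L P (\<lambda>\<omega>. \<xi> k \<omega> \<otimes>\<^sub>v \<xi> l \<omega>) =
      integral\<^sup>L (distr P ?\<Pi> (\<lambda>\<omega> n. \<xi> (n + k) \<omega>)) (\<lambda>x. x 0 \<otimes>\<^sub>v x (l - k))"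
    using assms(2) by (subst integral_distr[OF path f]) simp
  also have "\<dots> = integral\<^sup>L (distr P ?\<Pi> (\<lambda>\<omega> n. \<xi> (n + 0) \<omega>)) (\<lambda>x. x 0 \<otimes>\<^sub>v x (l - k))"
    using assms(1) by (simp add: stationary_process_def)
  also have "\<dots> = integral\<^sup>L P (\<lambda>\<omega>. \<xi> 0 \<omega> \<otimes>\<^sub>v \<xi> (l - k) \<omega>)"
    by (subst integral_distr[OF path f]) simp
  finally show ?thesis by (simp add: correlation_def)
qed

text \<open>
  Of the index pairs in the square, those below the diagonal mirror those above it, and exchanging
  the factors of an outer product is transposition.
\<close>

lemma outer_sum_decompose:
  fixes x :: "nat \<Rightarrow> real ^ 'd"
  shows "(\<Sum>k<N. x k) \<otimes>\<^sub>v (\<Sum>k<N. x k) =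
    (\<Sum>k<N. x k \<otimes>\<^sub>v x k) + (\<Sum>l<N. \<Sum>k<l. x k \<otimes>\<^sub>v x l) + transpose (\<Sum>l<N. \<Sum>k<l. x k \<otimes>\<^sub>v x l)"
proof (induction N)
  case 0
  show ?case by (simp add: outer.zero_left vec_eq_iff)
next
  case (Suc N)
  interpret tr: bounded_linear "transpose :: real ^ 'd ^ 'd \<Rightarrow> real ^ 'd ^ 'd"
    by (rule bounded_linear_transpose)
  have "transpose (\<Sum>k<N. x k \<otimes>\<^sub>v x N) = x N \<otimes>\<^sub>v (\<Sum>k<N. x k)"
    by (simp add: outer.sum_left[symmetric] vec_eq_iff mult.commute)
  then show ?case
    using Suc by (simp add: outer.add_left outer.add_right tr.add outer.sum_left)
qed

lemma partial_sum_outer_decompose: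
  fixes \<xi> :: "nat \<Rightarrow> 'a \<Rightarrow> real ^ 'd"
  shows "partial_sum \<xi> N 1 \<omega> \<otimes>\<^sub>v partial_sum \<xi> N 1 \<omega> =
    (1 / real N) *\<^sub>R (\<Sum>k<N. \<xi> k \<omega> \<otimes>\<^sub>v \<xi> k \<omega>) + iterated_sum \<xi> N 1 \<omega> + transpose (iterated_sum \<xi> N 1 \<omega>)"
  by (simp add: partial_sum_def iterated_sum_def outer.scaleR_left outer.scaleR_right
      outer_sum_decompose scaleR_right_distrib linear_cmul[OF bounded_linear.linear[OF bounded_linear_transpose]])

text \<open>
  For fixed \<open>l\<close>, the gaps \<open>l - k\<close> with \<open>k < l\<close> run through \<open>1, \<dots>, l\<close>, so the inner sum is a
  partial sum of the correlation series.
\<close>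

lemma expectation_iterated_sum:
  fixes \<xi> :: "nat \<Rightarrow> 'a \<Rightarrow> real ^ 'd"
  assumes "stationary_process P \<xi>" and "\<And>k. integrable P (\<lambda>\<omega>. (norm (\<xi> k \<omega>))\<^sup>2)"
  shows "integral\<^sup>L P (iterated_sum \<xi> N 1) =
    (1 / real N) *\<^sub>R (\<Sum>l<N. \<Sum>n<l. correlation P \<xi> (Suc n))"
proof -
  have [simp]: "integrable P (\<lambda>\<omega>. \<xi> k \<omega> \<otimes>\<^sub>v \<xi> l \<omega>)" for k l
    using assms by (intro integrable_outer) (auto simp: stationary_process_def)
  have gaps: "(\<Sum>k<l. correlation P \<xi> (l - k)) = (\<Sum>n<l. correlation P \<xi> (Suc n))" for l
    by (subst sum.nat_diff_reindex[symmetric]) (auto intro!: sum.cong simp: Suc_diff_Suc)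
  have "integral\<^sup>L P (iterated_sum \<xi> N 1) =
      (1 / real N) *\<^sub>R (\<Sum>l<N. \<Sum>k<l. integral\<^sup>L P (\<lambda>\<omega>. \<xi> k \<omega> \<otimes>\<^sub>v \<xi> l \<omega>))"
    by (simp add: iterated_sum_def[abs_def])
  also have "\<dots> = (1 / real N) *\<^sub>R (\<Sum>l<N. \<Sum>k<l. correlation P \<xi> (l - k))"
    by (simp add: stationary_expectation_outer[OF assms(1)])
  finally show ?thesis by (simp add: gaps)
qed

lemma expectation_partial_sum_outer:
  fixes \<xi> :: "nat \<Rightarrow> 'a \<Rightarrow> real ^ 'd"
  assumes "stationary_process P \<xi>" and "\<And>k. integrable P (\<lambda>\<omega>. (norm (\<xi> k \<omega>))\<^sup>2)" and "N \<ge> 1"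
  shows "integral\<^sup>L P (\<lambda>\<omega>. partial_sum \<xi> N 1 \<omega> \<otimes>\<^sub>v partial_sum \<xi> N 1 \<omega>) =
    correlation P \<xi> 0 + integral\<^sup>L P (iterated_sum \<xi> N 1) + transpose (integral\<^sup>L P (iterated_sum \<xi> N 1))"
proof -
  have int [simp]: "integrable P (\<lambda>\<omega>. \<xi> k \<omega> \<otimes>\<^sub>v \<xi> l \<omega>)" for k l
    using assms by (intro integrable_outer) (auto simp: stationary_process_def)
  have SS [simp]: "integrable P (iterated_sum \<xi> N 1)"
    by (simp add: iterated_sum_def[abs_def])
  have [simp]: "integrable P (\<lambda>\<omega>. transpose (iterated_sum \<xi> N 1 \<omega>))"
    by (rule integrable_bounded_linear[OF bounded_linear_transpose SS])
  have "integral\<^sup>L P (\<lambda>\<omega>. \<xi> k \<omega> \<otimes>\<^sub>v \<xi> k \<omega>) = correlation P \<xi> 0" for k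
    using stationary_expectation_outer[OF assms(1), of k k] by simp
  then have "(1 / real N) *\<^sub>R (\<Sum>k<N. integral\<^sup>L P (\<lambda>\<omega>. \<xi> k \<omega> \<otimes>\<^sub>v \<xi> k \<omega>)) = correlation P \<xi> 0"
    using assms(3) by (simp add: sum_constant_scaleR del: sum_constant)
  then show ?thesis
    by (simp add: partial_sum_outer_decompose
        integral_bounded_linear[OF bounded_linear_transpose SS])
qed

section \<open>Moments of the Brownian rough path\<close>

lemma centred_normal_moments:
  assumes "prob_space M" and "centred_normal M v X"
  shows "integrable M (\<lambda>\<omega>. (X \<omega>)\<^sup>2)" "integrable M X"
    "integral\<^sup>L M X = 0" "integral\<^sup>L M (\<lambda>\<omega>. (X \<omega>)\<^sup>2) = v"
proof -
  interpret prob_space M by fact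
  have [measurable]: "X \<in> borel_measurable M" and v: "0 \<le> v"
    using assms(2) by (auto simp: centred_normal_def)
  have "integrable M (\<lambda>\<omega>. (X \<omega>)\<^sup>2) \<and> expectation X = 0 \<and> expectation (\<lambda>\<omega>. (X \<omega>)\<^sup>2) = v"
  proof (cases "v = 0")
    case True
    then have *: "AE \<omega> in M. X \<omega> = 0" using assms(2) by (simp add: centred_normal_def)
    have "integrable M (\<lambda>\<omega>. (X \<omega>)\<^sup>2)"
      by (subst integrable_cong_AE[where g = "\<lambda>_. 0"]) (use * in auto)
    moreover have "expectation X = expectation (\<lambda>_. 0)"
      by (rule integral_cong_AE) (use * in auto)
    moreover have "expectation (\<lambda>\<omega>. (X \<omega>)\<^sup>2) = expectation (\<lambda>_. 0)"
      by (rule integral_cong_AE) (use * in auto)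
    ultimately show ?thesis using True by simp
  next
    case False
    then have D: "distributed M lborel X (normal_density 0 (sqrt v))" and s: "0 < sqrt v"
      using assms(2) v by (auto simp: centred_normal_def)
    have "integrable M (\<lambda>\<omega>. (X \<omega>)\<^sup>2)"
      using integrable_normal_moment[OF s, of 0 2]
      by (subst distributed_integrable[OF D, symmetric]) auto
    with normal_distributed_expectation[OF s D] normal_distributed_variance[OF s D] v
    show ?thesis by simp
  qed
  then show "integrable M (\<lambda>\<omega>. (X \<omega>)\<^sup>2)" "integrable M X"
    "integral\<^sup>L M X = 0" "integral\<^sup>L M (\<lambda>\<omega>. (X \<omega>)\<^sup>2) = v"
    by (auto intro: square_integrable_imp_integrable)
qed

lemma brownian_motion_increment_normal:
  assumes "brownian_motion M C B" "0 \<le> s" "s < t"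
  shows "centred_normal M ((t - s) * (u \<bullet> (C *v u))) (\<lambda>\<omega>. u \<bullet> (B t \<omega> - B s \<omega>))"
  using assms unfolding brownian_motion_def by blast

text \<open>
  Both matrices are symmetric and have the same quadratic form, namely the variance of \<open>u \<bullet> B 1\<close>.
  Normality is known for increments only, so \<open>B 1\<close> is read as the increment from time 0.
\<close>

lemma brownian_motion_covariance:
  fixes C :: "real ^ 'd ^ 'd"
  assumes bm: "brownian_motion M C B" and int: "integrable M (\<lambda>\<omega>. B 1 \<omega> \<otimes>\<^sub>v B 1 \<omega>)"
  shows "integral\<^sup>L M (\<lambda>\<omega>. B 1 \<omega> \<otimes>\<^sub>v B 1 \<omega>) = C"
proof (rule symmetric_matrix_eqI)
  interpret prob_space M using bm by (simp add: brownian_motion_def)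
  have [measurable]: "B 1 \<in> borel_measurable M" "B 0 \<in> borel_measurable M"
    using bm by (auto simp: brownian_motion_def)
  show "transpose C = C" using bm by (simp add: brownian_motion_def)
  have "transpose (x \<otimes>\<^sub>v x) = x \<otimes>\<^sub>v x" for x :: "real ^ 'd"
    by (simp add: vec_eq_iff mult.commute)
  then show "transpose (integral\<^sup>L M (\<lambda>\<omega>. B 1 \<omega> \<otimes>\<^sub>v B 1 \<omega>)) = integral\<^sup>L M (\<lambda>\<omega>. B 1 \<omega> \<otimes>\<^sub>v B 1 \<omega>)"
    by (simp add: integral_bounded_linear[OF bounded_linear_transpose int, symmetric])
  fix u
  have cn: "centred_normal M (u \<bullet> (C *v u)) (\<lambda>\<omega>. u \<bullet> (B 1 \<omega> - B 0 \<omega>))"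
    using brownian_motion_increment_normal[OF bm, of 0 1 u] by simp
  have "u \<bullet> (integral\<^sup>L M (\<lambda>\<omega>. B 1 \<omega> \<otimes>\<^sub>v B 1 \<omega>) *v u) = integral\<^sup>L M (\<lambda>\<omega>. (u \<bullet> B 1 \<omega>)\<^sup>2)"
    by (simp add: integral_bounded_linear[OF bounded_linear_quadratic_form int, symmetric]
        quadratic_form_outer)
  also have "\<dots> = integral\<^sup>L M (\<lambda>\<omega>. (u \<bullet> (B 1 \<omega> - B 0 \<omega>))\<^sup>2)"
    using bm by (intro integral_cong_AE) (auto simp: brownian_motion_def)
  also have "\<dots> = u \<bullet> (C *v u)"
    by (rule centred_normal_moments(4)[OF prob_space_axioms cn])
  finally show "u \<bullet> (integral\<^sup>L M (\<lambda>\<omega>. B 1 \<omega> \<otimes>\<^sub>v B 1 \<omega>) *v u) = u \<bullet> (C *v u)" .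
qed

lemma space_natural_filtration [simp]: "space (natural_filtration M X s) = space M"
proof -
  have "sets (vimage_algebra (space M) (X r) borel) \<subseteq> Pow (space M)" for r
    by (metis sets.space_closed space_vimage_algebra)
  then show ?thesis
    unfolding natural_filtration_def by (intro space_measure_of) blast
qed

lemma subalgebra_natural_filtration:
  fixes X :: "real \<Rightarrow> 'a \<Rightarrow> 'b::topological_space"
  assumes "\<And>r. 0 \<le> r \<Longrightarrow> X r \<in> borel_measurable M"
  shows "subalgebra M (natural_filtration M X s)"
proof -
  have "sets (vimage_algebra (space M) (X r) borel) \<subseteq> sets M" if "0 \<le> r" for r
    using assms[OF that] by (auto simp: sets_vimage_algebra2 measurable_sets)
  then have "(\<Union>r\<in>{0..s}. sets (vimage_algebra (space M) (X r) borel)) \<subseteq> sets M"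
    by (intro UN_least) simp
  moreover have "(\<Union>r\<in>{0..s}. sets (vimage_algebra (space M) (X r) borel)) \<subseteq> Pow (space M)"
    using calculation sets.space_closed by (rule subset_trans)
  ultimately have "sets (natural_filtration M X s) \<subseteq> sets M"
    unfolding natural_filtration_def by (simp add: sets_measure_of sets.sigma_sets_subset)
  then show ?thesis by (simp add: subalgebra_def)
qed

text \<open>
  The martingale property behind the Ito integral: \<open>\<eta>\<close> is known at time \<open>s\<close>, hence independent of
  the increment over \<open>[s, t]\<close>, and the expectation of the product factorises.
\<close>

lemma adapted_times_increment:
  assumes bm: "brownian_motion M C B" and s: "0 \<le> s" and t: "s < t"
    and \<eta>: "\<eta> \<in> borel_measurable (natural_filtration M B s)" and \<eta>2: "integrable M (\<lambda>\<omega>. (\<eta> \<omega>)\<^sup>2)"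
  shows "integrable M (\<lambda>\<omega>. \<eta> \<omega> * (B t \<omega> $ j - B s \<omega> $ j))"
    and "integral\<^sup>L M (\<lambda>\<omega>. \<eta> \<omega> * (B t \<omega> $ j - B s \<omega> $ j)) = 0"
proof -
  interpret prob_space M using bm by (simp add: brownian_motion_def)
  have B: "B r \<in> borel_measurable M" if "0 \<le> r" for r
    using bm that by (simp add: brownian_motion_def)
  have [measurable]: "B t \<in> borel_measurable M" "B s \<in> borel_measurable M"
    using B s t by auto
  let ?F = "natural_filtration M B s" and ?D = "\<lambda>\<omega>. B t \<omega> - B s \<omega>"
  let ?V = "vimage_algebra (space M) ?D borel"
  have sub: "subalgebra M ?F" using B by (rule subalgebra_natural_filtration)
  have \<eta>m [measurable]: "\<eta> \<in> borel_measurable M"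
    using \<eta> sub by (rule measurable_from_subalg[rotated])
  have indep: "indep_set (sets ?F) (sets ?V)"
    using bm s t by (simp add: brownian_motion_def)
  have cn: "centred_normal M ((t - s) * (axis j 1 \<bullet> (C *v axis j 1))) (\<lambda>\<omega>. axis j 1 \<bullet> ?D \<omega>)"
    by (rule brownian_motion_increment_normal[OF bm s t])
  then have cn: "centred_normal M ((t - s) * (axis j 1 \<bullet> (C *v axis j 1))) (\<lambda>\<omega>. B t \<omega> $ j - B s \<omega> $ j)"
    by (simp add: inner_axis')
  note mom = centred_normal_moments[OF prob_space_axioms cn]
  have Dj: "(\<lambda>\<omega>. B t \<omega> $ j - B s \<omega> $ j) \<in> borel_measurable ?V"
  proof -
    have "?D \<in> borel_measurable ?V" by (rule measurable_vimage_algebra1) auto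
    then have "(\<lambda>\<omega>. ?D \<omega> $ j) \<in> borel_measurable ?V"
      by (rule measurable_compose) (intro borel_measurable_continuous_onI continuous_intros)
    then show ?thesis by simp
  qed
  \<comment> \<open>Independence is given for sigma-algebras that are larger than those generated by \<open>\<eta>\<close> and by
    a single coordinate of the increment.\<close>
  have gen: "sigma_sets (space M) {X -` A \<inter> space M |A. A \<in> sets borel} \<subseteq> sets G"
    if "X \<in> borel_measurable G" "space G = space M" for X :: "'a \<Rightarrow> real" and G
  proof -
    have "{X -` A \<inter> space M |A. A \<in> sets borel} \<subseteq> sets G"
      using measurable_sets[OF that(1)] that(2) by auto
    then show ?thesis using sets.sigma_sets_subset[of _ G] that(2) by simp
  qed
  have "indep_var borel \<eta> borel (\<lambda>\<omega>. B t \<omega> $ j - B s \<omega> $ j)"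
    unfolding indep_var_eq
  proof (intro conjI)
    show "indep_set (sigma_sets (space M) {\<eta> -` A \<inter> space M |A. A \<in> sets borel})
       (sigma_sets (space M) {(\<lambda>\<omega>. B t \<omega> $ j - B s \<omega> $ j) -` A \<inter> space M |A. A \<in> sets borel})"
      using indep unfolding indep_set_def
      by (rule indep_sets_mono_sets) (use gen[OF \<eta>] gen[OF Dj] in \<open>auto split: bool.split\<close>)
    show "random_variable borel (\<lambda>\<omega>. B t \<omega> $ j - B s \<omega> $ j)"
      using cn by (simp add: centred_normal_def)
  qed (rule \<eta>m)
  note product = this square_integrable_imp_integrable[OF \<eta>m \<eta>2] mom(2)
  show "integrable M (\<lambda>\<omega>. \<eta> \<omega> * (B t \<omega> $ j - B s \<omega> $ j))"
    using product by (rule indep_var_integrable)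
  show "integral\<^sup>L M (\<lambda>\<omega>. \<eta> \<omega> * (B t \<omega> $ j - B s \<omega> $ j)) = 0"
    by (subst indep_var_lebesgue_integral[OF product]) (simp only: mom(3) mult_zero_right)
qed

lemma simple_integral_mean_zero:
  assumes bm: "brownian_motion M C B"
    and si: "simple_integrand M (natural_filtration M B) t n \<tau> \<eta>"
  shows "integrable M (simple_integral (\<lambda>s \<omega>. B s \<omega> $ j) n \<tau> \<eta>)"
    and "integral\<^sup>L M (simple_integral (\<lambda>s \<omega>. B s \<omega> $ j) n \<tau> \<eta>) = 0"
proof -
  have pos: "0 \<le> \<tau> k" if "k \<le> n" for k
    using that
  proof (induction k)
    case 0
    then show ?case using si by (simp add: simple_integrand_def)
  next
    case (Suc k)
    then have "\<tau> k < \<tau> (Suc k)" using si by (simp add: simple_integrand_def)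
    with Suc show ?case by simp
  qed
  have *: "integrable M (\<lambda>\<omega>. \<eta> k \<omega> * (B (\<tau> (Suc k)) \<omega> $ j - B (\<tau> k) \<omega> $ j)) \<and>
      integral\<^sup>L M (\<lambda>\<omega>. \<eta> k \<omega> * (B (\<tau> (Suc k)) \<omega> $ j - B (\<tau> k) \<omega> $ j)) = 0" if "k < n" for k
    using that si pos[of k] adapted_times_increment[OF bm, of "\<tau> k" "\<tau> (Suc k)" "\<eta> k" j]
    by (simp add: simple_integrand_def)
  show "integrable M (simple_integral (\<lambda>s \<omega>. B s \<omega> $ j) n \<tau> \<eta>)"
    unfolding simple_integral_def[abs_def] using * by (intro Bochner_Integration.integrable_sum) auto
  show "integral\<^sup>L M (simple_integral (\<lambda>s \<omega>. B s \<omega> $ j) n \<tau> \<eta>) = 0"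
    unfolding simple_integral_def[abs_def] using * by (subst Bochner_Integration.integral_sum) auto
qed

text \<open>
  Nonnegativity of the variance, stated with the nonnegative integral so that \<open>X\<close> may fail to be
  square integrable; this is the form in which \<open>L\<^sup>2\<close> convergence to an Ito integral is given.
\<close>

lemma (in prob_space) square_expectation_le:
  fixes X :: "'a \<Rightarrow> real"
  assumes X: "integrable M X"
  shows "ennreal ((expectation X)\<^sup>2) \<le> (\<integral>\<^sup>+ \<omega>. ennreal ((X \<omega>)\<^sup>2) \<partial>M)"
proof (cases "integrable M (\<lambda>\<omega>. (X \<omega>)\<^sup>2)")
  case True
  have "(expectation X)\<^sup>2 \<le> expectation (\<lambda>\<omega>. (X \<omega>)\<^sup>2)"
    using variance_positive[of X] variance_eq[OF X True] by simp
  then show ?thesis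
    using True by (simp add: nn_integral_eq_integral)
next
  case False
  then have "(\<integral>\<^sup>+ \<omega>. ennreal ((X \<omega>)\<^sup>2) \<partial>M) = \<infinity>"
    using X by (auto simp: integrable_iff_bounded simp flip: less_top)
  then show ?thesis by simp
qed

text \<open>
  An \<open>L\<^sup>2\<close> limit of variables with mean zero has mean zero: the squared mean of \<open>I\<close> is bounded by
  the squared \<open>L\<^sup>2\<close> distance to each approximation.
\<close>

lemma ito_integral_mean_zero:
  assumes bm: "brownian_motion M C B"
    and ito: "has_ito_integral M (natural_filtration M B) H (\<lambda>s \<omega>. B s \<omega> $ j) t I"
    and I: "integrable M I"
  shows "integral\<^sup>L M I = 0"
proof -
  interpret prob_space M using bm by (simp add: brownian_motion_def)
  let ?W = "\<lambda>s \<omega>. B s \<omega> $ j"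
  obtain n \<tau> \<eta> where si: "\<And>m. simple_integrand M (natural_filtration M B) t (n m) (\<tau> m) (\<eta> m)"
    and lim: "(\<lambda>m. \<integral>\<^sup>+ \<omega>. ennreal ((simple_integral ?W (n m) (\<tau> m) (\<eta> m) \<omega> - I \<omega>)\<^sup>2) \<partial>M) \<longlonglongrightarrow> 0"
    using ito unfolding has_ito_integral_def by blast
  have "ennreal ((expectation I)\<^sup>2)
      \<le> (\<integral>\<^sup>+ \<omega>. ennreal ((simple_integral ?W (n m) (\<tau> m) (\<eta> m) \<omega> - I \<omega>)\<^sup>2) \<partial>M)" for m
  proof -
    note S = simple_integral_mean_zero[OF bm si[of m], of j]
    have "expectation (\<lambda>\<omega>. simple_integral ?W (n m) (\<tau> m) (\<eta> m) \<omega> - I \<omega>) = - expectation I"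
      using S I by simp
    then show ?thesis
      using square_expectation_le[of "\<lambda>\<omega>. simple_integral ?W (n m) (\<tau> m) (\<eta> m) \<omega> - I \<omega>"] S I
      by simp
  qed
  then have "ennreal ((expectation I)\<^sup>2) \<le> 0"
    by (intro LIMSEQ_le_const[OF lim]) auto
  then show ?thesis by simp
qed

lemma brownian_rough_path_mean:
  assumes brp: "brownian_rough_path M C \<Gamma> B BB" and BB: "integrable M (BB 1)"
  shows "integral\<^sup>L M (BB 1) = \<Gamma>"
proof -
  have bm: "brownian_motion M C B" using brp by (simp add: brownian_rough_path_def)
  interpret prob_space M using bm by (simp add: brownian_motion_def)
  have ent: "integrable M (\<lambda>\<omega>. BB 1 \<omega> $ i $ j)" for i j
    by (rule integrable_bounded_linear[OF bounded_linear_entry BB])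
  have "integral\<^sup>L M (BB 1) $ i $ j = \<Gamma> $ i $ j" for i j
  proof -
    have "has_ito_integral M (natural_filtration M B) (\<lambda>s \<omega>. B s \<omega> $ i) (\<lambda>s \<omega>. B s \<omega> $ j) 1
        (\<lambda>\<omega>. BB 1 \<omega> $ i $ j - \<Gamma> $ i $ j)"
      using brp unfolding brownian_rough_path_def by (metis mult_1 zero_le_one)
    then have "expectation (\<lambda>\<omega>. BB 1 \<omega> $ i $ j - \<Gamma> $ i $ j) = 0"
      using ent by (intro ito_integral_mean_zero[OF bm]) auto
    then show ?thesis
      using ent by (simp add: prob_space integral_bounded_linear[OF bounded_linear_entry BB])
  qed
  then show ?thesis by (simp add: vec_eq_iff)
qed

section \<open>Identification of the characteristics\<close>

theorem theorem1:
  fixes P :: "'a measure" and \<xi> :: "nat \<Rightarrow> 'a \<Rightarrow> real ^ 'd"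
    and Q :: "'b measure" and B :: "real \<Rightarrow> 'b \<Rightarrow> real ^ 'd" and BB :: "real \<Rightarrow> 'b \<Rightarrow> real ^ 'd ^ 'd"
    and C \<Gamma> :: "real ^ 'd ^ 'd"
  assumes "prob_space P"
    and "stationary_process P \<xi>"
    and "\<And>k. integrable P (\<lambda>\<omega>. (norm (\<xi> k \<omega>))\<^sup>2)"
    and "prob_space.expectation P (\<xi> 0) = 0"
    and "summable (\<lambda>n. correlation P \<xi> (Suc n))"
    and "brownian_rough_path Q C \<Gamma> B BB"
    and "iterated_invariance_principle (\<lambda>_. P) (partial_sum \<xi>) (iterated_sum \<xi>) Q B BB"
  shows "C = correlation P \<xi> 0 + 2 *\<^sub>R Sym \<Gamma> \<and> \<Gamma> = (\<Sum>n. correlation P \<xi> (Suc n))"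
proof -
  have bm: "brownian_motion Q C B" using assms(6) by (simp add: brownian_rough_path_def)
  have C: "integral\<^sup>L Q (\<lambda>\<omega>. B 1 \<omega> \<otimes>\<^sub>v B 1 \<omega>) = C" and \<Gamma>: "integral\<^sup>L Q (BB 1) = \<Gamma>"
    using brownian_motion_covariance[OF bm] brownian_rough_path_mean[OF assms(6)] assms(7)
    by (simp_all add: iterated_invariance_principle_def)
  have limC: "(\<lambda>N. integral\<^sup>L P (\<lambda>\<omega>. partial_sum \<xi> N 1 \<omega> \<otimes>\<^sub>v partial_sum \<xi> N 1 \<omega>)) \<longlonglongrightarrow> C"
    and lim\<Gamma>: "(\<lambda>N. integral\<^sup>L P (iterated_sum \<xi> N 1)) \<longlonglongrightarrow> \<Gamma>"
    using assms(7) by (simp_all add: iterated_invariance_principle_def C \<Gamma>)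
  have "(\<lambda>N. integral\<^sup>L P (iterated_sum \<xi> N 1)) \<longlonglongrightarrow> (\<Sum>n. correlation P \<xi> (Suc n))"
    unfolding expectation_iterated_sum[OF assms(2,3)]
    by (intro cesaro_mean_tendsto summable_LIMSEQ assms(5))
  with lim\<Gamma> have "\<Gamma> = (\<Sum>n. correlation P \<xi> (Suc n))" by (rule LIMSEQ_unique)
  moreover
  have "(\<lambda>N. correlation P \<xi> 0 + integral\<^sup>L P (iterated_sum \<xi> N 1)
      + transpose (integral\<^sup>L P (iterated_sum \<xi> N 1))) \<longlonglongrightarrow> correlation P \<xi> 0 + \<Gamma> + transpose \<Gamma>"
    by (intro tendsto_intros lim\<Gamma> bounded_linear.tendsto[OF bounded_linear_transpose])
  \<comment> \<open>The decomposition of the second moment needs \<open>N \<ge> 1\<close>: at \<open>N = 0\<close> division by zero removes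
    the diagonal.\<close>
  then have "(\<lambda>N. integral\<^sup>L P (\<lambda>\<omega>. partial_sum \<xi> N 1 \<omega> \<otimes>\<^sub>v partial_sum \<xi> N 1 \<omega>))
      \<longlonglongrightarrow> correlation P \<xi> 0 + \<Gamma> + transpose \<Gamma>"
    by (rule Lim_transform_eventually)
      (auto simp: expectation_partial_sum_outer[OF assms(2,3)] intro!: eventually_sequentiallyI[of 1])
  with limC have "C = correlation P \<xi> 0 + \<Gamma> + transpose \<Gamma>" by (rule LIMSEQ_unique)
  then have "C = correlation P \<xi> 0 + 2 *\<^sub>R Sym \<Gamma>" by (simp add: Sym_def add.assoc)
  ultimately show ?thesis by blast
qed

end
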